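(* Let $D=\{(x_i,y_i):i\in[m]\}\subset\mathcal{X}\times\{+1,-1\}$ be a labeled dataset of size $m$ with positive label ratio $r>0$. Let $\nu,\mu$ be real numbers with $0\le\mu<\nu<1$ such that $\nu m$ and $\mu m$ are natural numbers ($0$ being allowed), and assume $\mu<r/2$. Then the following two conditions are equivalent: (i) $\nu-\mu\le 2(r-2\mu)$. (ii) $\sup\{\mathrm{opt}(\nu,\mu;D')\,:\,D'\in\mathcal{D}_{\mu m}\}<\infty$, where $\mathcal{D}_{\mu m}$ is the family of contaminated datasets defined from $D$.
   Context: Let $\mathcal{X}$ be a (nonempty) input space and $\mathcal{H}$ a reproducing kernel Hilbert space (RKHS) of real functions on $\mathcal{X}$ with kernel $k:\mathcal{X}^2\to\mathbb{R}$ and norm $\|\cdot\|_{\mathcal{H}}$. Write $[m]=\{1,\ldots,m\}$. A dataset of size $m$ is a collection $D=\{(x_i,y_i):i\in[m]\}$ of labeled points of $\mathcal{X}\times\{+1,-1\}$ (repetitions are allowed and counted with multiplicity). Its label ratio is $$r=\frac1m\min\{\,|\{i:y_i=+1\}|,\ |\{i:y_i=-1\}|\,\}.$$ For a dataset $D$ of size $m$ and an integer $0\le\kappa\le m$, the family of contaminated datasets is $$\mathcal{D}_\kappa=\{D'=\{(x_i',y_i'):i\in[m]\}\subset\mathcal{X}\times\{+1,-1\}\,:\,|D'\cap D|\ge m-\kappa\},$$ i.e. all datasets of size $m$ having at least $m-\kappa$ elements in common with $D$ (equivalently, obtained from $D$ by replacing at most $\kappa$ of its samples by arbitrary labeled points).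 Let $E_\mu=\{(\eta_1,\ldots,\eta_m)^T\in\{0,1\}^m:\sum_{i=1}^m\eta_i\ge m(1-\mu)\}$. For a dataset $D=\{(x_i,y_i):i\in[m]\}$ and $\eta\in E_\mu$, define the reduced convex hulls $$\mathcal{U}_\eta^{\pm}[\nu,\mu;D]=\Big\{\sum_{i:y_i=\pm1}\gamma_i k(\cdot,x_i)\in\mathcal{H}\,:\,\sum_{i:y_i=\pm1}\gamma_i=1,\ 0\le\gamma_i\le\frac{2\eta_i}{(\nu-\mu)m}\ \text{for all } i \text{ with } y_i=\pm1\Big\},$$ the set $\mathcal{V}_\eta[\nu,\mu;D]=\{a-b: a\in\mathcal{U}_\eta^{+}[\nu,\mu;D],\ b\in\mathcal{U}_\eta^{-}[\nu,\mu;D]\}$, and $$\mathrm{opt}(\nu,\mu;D)=\max_{\eta\in E_\mu}\ \min_{f\in\mathcal{V}_\eta[\nu,\mu;D]}\|f\|_{\mathcal{H}}^2,$$ with the convention that the minimum over the empty set is $+\infty$. *)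

theory Defs
  imports Complex_Main "HOL-Library.Extended_Real" "HOL-Library.Multiset" "HOL-Library.FuncSet"
begin

text \<open>The (nonempty) input space is the type \<open>'x\<close>. An RKHS is given by its carrier \<open>H\<close>, a set of
  real functions on \<open>'x\<close> with pointwise operations, its inner product \<open>ip\<close> (only meaningful
  on \<open>H\<close>), and its reproducing kernel \<open>k\<close>.\<close>

definition hnorm :: "(('x \<Rightarrow> real) \<Rightarrow> ('x \<Rightarrow> real) \<Rightarrow> real) \<Rightarrow> ('x \<Rightarrow> real) \<Rightarrow> real" where
  "hnorm ip f = sqrt (ip f f)"

locale rkhs =
  fixes H :: "('x \<Rightarrow> real) set"
    and ip :: "('x \<Rightarrow> real) \<Rightarrow> ('x \<Rightarrow> real) \<Rightarrow> real"
    and k :: "'x \<Rightarrow> 'x \<Rightarrow> real"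
  assumes zero_mem: "(\<lambda>_. 0) \<in> H"
    and add_mem: "f \<in> H \<Longrightarrow> g \<in> H \<Longrightarrow> (\<lambda>u. f u + g u) \<in> H"
    and scale_mem: "f \<in> H \<Longrightarrow> (\<lambda>u. c * f u) \<in> H"
    and ip_commute: "f \<in> H \<Longrightarrow> g \<in> H \<Longrightarrow> ip f g = ip g f"
    and ip_add_left: "f \<in> H \<Longrightarrow> g \<in> H \<Longrightarrow> h \<in> H \<Longrightarrow> ip (\<lambda>u. f u + g u) h = ip f h + ip g h"
    and ip_scale_left: "f \<in> H \<Longrightarrow> g \<in> H \<Longrightarrow> ip (\<lambda>u. c * f u) g = c * ip f g"
    and ip_nonneg: "f \<in> H \<Longrightarrow> 0 \<le> ip f f"
    and ip_definite: "f \<in> H \<Longrightarrow> ip f f = 0 \<Longrightarrow> f = (\<lambda>_. 0)"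
    and complete: "(\<And>n. F n \<in> H) \<Longrightarrow>
      (\<And>e. e > 0 \<Longrightarrow> \<exists>N. \<forall>i\<ge>N. \<forall>j\<ge>N. hnorm ip (\<lambda>u. F i u - F j u) < e) \<Longrightarrow>
      \<exists>f\<in>H. (\<lambda>n. hnorm ip (\<lambda>u. F n u - f u)) \<longlonglongrightarrow> 0"
    and kernel_mem: "(\<lambda>u. k u x) \<in> H"
    and reproducing: "f \<in> H \<Longrightarrow> f x = ip f (\<lambda>u. k u x)"

text \<open>Datasets are lists, so that samples are indexed by \<open>{..<m}\<close> and repetitions count. The order
  is immaterial: it affects none of the notions below except through a relabelling of indices.\<close>

type_synonym 'x dataset = "('x \<times> int) list"

definition is_dataset :: "nat \<Rightarrow> 'x dataset \<Rightarrow> bool" where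
  "is_dataset m D \<longleftrightarrow> length D = m \<and> set D \<subseteq> UNIV \<times> {1, -1}"

definition class_idx :: "int \<Rightarrow> 'x dataset \<Rightarrow> nat set" where
  "class_idx s D = {i. i < length D \<and> snd (D ! i) = s}"

definition label_ratio :: "'x dataset \<Rightarrow> real" where
  "label_ratio D =
    1 / real (length D) * real (min (card (class_idx 1 D)) (card (class_idx (-1) D)))"

definition contaminated :: "nat \<Rightarrow> 'x dataset \<Rightarrow> 'x dataset set" where
  "contaminated \<kappa> D =
    {D'. is_dataset (length D) D' \<and> size (mset D' \<inter># mset D) \<ge> length D - \<kappa>}"

definition outlier_ind :: "nat \<Rightarrow> real \<Rightarrow> (nat \<Rightarrow> real) set" where
  "outlier_ind m \<mu> = {\<eta> \<in> {..<m} \<rightarrow>\<^sub>E {0, 1}. (\<Sum>i<m. \<eta> i) \<ge> real m * (1 - \<mu>)}"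

definition reduced_hull ::
  "('x \<Rightarrow> 'x \<Rightarrow> real) \<Rightarrow> int \<Rightarrow> (nat \<Rightarrow> real) \<Rightarrow> real \<Rightarrow> real \<Rightarrow> 'x dataset \<Rightarrow> ('x \<Rightarrow> real) set" where
  "reduced_hull k s \<eta> \<nu> \<mu> D =
    {(\<lambda>u. \<Sum>i\<in>class_idx s D. \<gamma> i * k u (fst (D ! i))) | \<gamma>.
       (\<Sum>i\<in>class_idx s D. \<gamma> i) = 1 \<and>
       (\<forall>i\<in>class_idx s D. 0 \<le> \<gamma> i \<and> \<gamma> i \<le> 2 * \<eta> i / ((\<nu> - \<mu>) * real (length D)))}"

definition hull_diff ::
  "('x \<Rightarrow> 'x \<Rightarrow> real) \<Rightarrow> (nat \<Rightarrow> real) \<Rightarrow> real \<Rightarrow> real \<Rightarrow> 'x dataset \<Rightarrow> ('x \<Rightarrow> real) set" where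
  "hull_diff k \<eta> \<nu> \<mu> D =
    {(\<lambda>u. a u - b u) | a b. a \<in> reduced_hull k 1 \<eta> \<nu> \<mu> D \<and> b \<in> reduced_hull k (-1) \<eta> \<nu> \<mu> D}"

text \<open>The set over which the infimum is taken is compact in the RKHS, so the infimum is a minimum
  whenever that set is nonempty; over the empty set it is \<open>\<infinity>\<close> in \<open>ereal\<close>, as required.
  The index set of the maximum is finite, and nonempty for \<open>\<mu> \<ge> 0\<close>.\<close>

definition opt ::
  "(('x \<Rightarrow> real) \<Rightarrow> ('x \<Rightarrow> real) \<Rightarrow> real) \<Rightarrow> ('x \<Rightarrow> 'x \<Rightarrow> real) \<Rightarrow> real \<Rightarrow> real \<Rightarrow> 'x dataset \<Rightarrow> ereal"
where
  "opt ip k \<nu> \<mu> D =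
    Max ((\<lambda>\<eta>. INF f \<in> hull_diff k \<eta> \<nu> \<mu> D. ereal ((hnorm ip f)\<^sup>2)) ` outlier_ind (length D) \<mu>)"

end

theory Submission
  imports Defs
begin

text \<open>Put \<open>n = r m\<close>, the size of the smaller class. Condition (i) says that \<open>n - 2\<kappa>\<close> weights, each at
  most \<open>2 / ((\<nu> - \<mu>) m)\<close>, can add up to \<open>1\<close>. Contamination destroys at most \<open>\<kappa>\<close> samples of a class and
  \<open>\<eta>\<close> discards at most \<open>\<kappa>\<close> more, so under (i) each reduced hull contains the mean of original
  samples, and the squared norm is bounded in terms of the kernel values on \<open>D\<close> alone. Conversely,
  flipping \<open>\<kappa>\<close> labels of the smaller class and discarding \<open>\<kappa>\<close> further samples of it leaves only
  \<open>n - 2\<kappa>\<close> usable samples, so if (i) fails a reduced hull becomes empty.\<close>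

section \<open>Norms of finite kernel combinations\<close>

context rkhs
begin

lemma kernel_sum_mem:
  "finite I \<Longrightarrow> (\<lambda>u. \<Sum>i\<in>I. c i * k u (x i)) \<in> H"
proof (induction I rule: finite_induct)
  case empty
  show ?case using zero_mem by simp
next
  case (insert a F)
  then show ?case
    using add_mem[OF scale_mem[OF kernel_mem] insert.IH] by simp
qed

lemma ip_kernel_sum:
  assumes "finite I" "h \<in> H"
  shows "ip (\<lambda>u. \<Sum>i\<in>I. c i * k u (x i)) h = (\<Sum>i\<in>I. c i * h (x i))"
  using assms(1)
proof (induction I rule: finite_induct)
  case empty
  \<comment> \<open>The empty sum is the zero function; homogeneity with scalar 0 makes its inner
    product with \<open>h\<close> vanish.\<close>
  show ?case using ip_scale_left[OF zero_mem assms(2), of 0] by simp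
next
  case (insert a F)
  have "ip (\<lambda>u. k u (x a)) h = h (x a)"
    using reproducing[OF assms(2)] ip_commute[OF kernel_mem assms(2)] by simp
  then have "ip (\<lambda>u. c a * k u (x a)) h = c a * h (x a)"
    using ip_scale_left[OF kernel_mem assms(2)] by simp
  then show ?case
    using insert ip_add_left[OF scale_mem[OF kernel_mem] kernel_sum_mem[OF insert.hyps(1)] assms(2),
        of "c a" "x a" c x]
    by simp
qed

text \<open>The reproducing property turns the squared norm into the quadratic form of the Gram
  matrix, which is then bounded entry by entry. Only kernel values at the points used enter, so the
  estimate cannot see where the contaminating points lie.\<close>

lemma hnorm_kernel_sum_le:
  assumes "finite I" and B: "\<And>i j. i \<in> I \<Longrightarrow> j \<in> I \<Longrightarrow> \<bar>k (x i) (x j)\<bar> \<le> B"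
  shows "(hnorm ip (\<lambda>u. \<Sum>i\<in>I. c i * k u (x i)))\<^sup>2 \<le> (\<Sum>i\<in>I. \<bar>c i\<bar>)\<^sup>2 * B"
proof -
  let ?f = "\<lambda>u. \<Sum>i\<in>I. c i * k u (x i)"
  have f: "?f \<in> H" by (rule kernel_sum_mem[OF assms(1)])
  have "(hnorm ip ?f)\<^sup>2 = (\<Sum>i\<in>I. \<Sum>j\<in>I. c i * c j * k (x i) (x j))"
    using ip_nonneg[OF f] ip_kernel_sum[OF assms(1) f]
    by (simp add: hnorm_def sum_distrib_left mult.assoc)
  also have "\<dots> \<le> (\<Sum>i\<in>I. \<Sum>j\<in>I. \<bar>c i\<bar> * \<bar>c j\<bar> * B)"
  proof (intro sum_mono)
    fix i j assume "i \<in> I" "j \<in> I"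
    have "c i * c j * k (x i) (x j) \<le> \<bar>c i\<bar> * \<bar>c j\<bar> * \<bar>k (x i) (x j)\<bar>"
      by (metis abs_ge_self abs_mult)
    also have "\<dots> \<le> \<bar>c i\<bar> * \<bar>c j\<bar> * B"
      using B[OF \<open>i \<in> I\<close> \<open>j \<in> I\<close>] by (intro mult_left_mono) auto
    finally show "c i * c j * k (x i) (x j) \<le> \<bar>c i\<bar> * \<bar>c j\<bar> * B" .
  qed
  also have "\<dots> = (\<Sum>i\<in>I. \<bar>c i\<bar>)\<^sup>2 * B"
    by (simp only: power2_eq_square sum_product) (simp only: sum_distrib_right)
  finally show ?thesis .
qed

end

section \<open>Class indices and outlier indicators\<close>

lemma finite_class_idx [simp]: "finite (class_idx s D)"
  by (simp add: class_idx_def)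

lemma class_idx_disjoint: "s \<noteq> t \<Longrightarrow> class_idx s D \<inter> class_idx t D = {}"
  by (auto simp: class_idx_def)

lemma finite_outlier_ind: "finite (outlier_ind m \<mu>)"
  by (rule finite_subset[OF _ finite_PiE[of "{..<m}" "\<lambda>_. {0, 1}"]])
    (auto simp: outlier_ind_def)

lemma outlier_ind_nonempty:
  assumes "0 \<le> \<mu>"
  shows "outlier_ind m \<mu> \<noteq> {}"
proof -
  have "restrict (\<lambda>_. 1) {..<m} \<in> outlier_ind m \<mu>"
    using assms by (auto simp: outlier_ind_def algebra_simps)
  then show ?thesis by blast
qed

text \<open>Since \<eta> takes only the values 0 and 1, the sum of \<open>1 - \<eta> i\<close>
  counts the discarded indices, and the defining inequality bounds that sum by
  \<open>\<mu> * real m\<close>.\<close>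

lemma outlier_ind_card_zero_le:
  assumes "\<eta> \<in> outlier_ind m \<mu>" "\<mu> * real m = real \<kappa>"
  shows "card {i. i < m \<and> \<eta> i \<noteq> 1} \<le> \<kappa>"
proof -
  have \<eta>: "\<eta> i = 0 \<or> \<eta> i = 1" if "i < m" for i
    using assms(1) that by (auto simp: outlier_ind_def PiE_def Pi_def)
  have "(\<Sum>i<m. 1 - \<eta> i) = (\<Sum>i<m. if \<eta> i \<noteq> 1 then 1 else 0)"
    using \<eta> by (intro sum.cong) auto
  also have "\<dots> = real (card ({..<m} \<inter> {i. \<eta> i \<noteq> 1}))"
    by (subst sum.If_cases) auto
  also have "{..<m} \<inter> {i. \<eta> i \<noteq> 1} = {i. i < m \<and> \<eta> i \<noteq> 1}" by auto
  finally have "real (card {i. i < m \<and> \<eta> i \<noteq> 1}) = real m - (\<Sum>i<m. \<eta> i)"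
    by (simp add: sum_subtractf)
  moreover have "(\<Sum>i<m. \<eta> i) \<ge> real m - real \<kappa>"
    using assms by (simp add: outlier_ind_def algebra_simps)
  ultimately show ?thesis by linarith
qed

text \<open>Supplies the witness for the converse: the discarding budget is spent exactly on
  \<open>T\<close>. \<open>restrict\<close> makes the indicator extensional, as membership
  demands.\<close>

lemma outlier_ind_discard:
  assumes "T \<subseteq> {..<m}" "\<mu> * real m = real (card T)"
  shows "restrict (\<lambda>i. if i \<in> T then 0 else 1) {..<m} \<in> outlier_ind m \<mu>"
proof -
  have "(\<Sum>i<m. if i \<in> T then 0 else 1) = real (card ({..<m} - T))"
    by (subst sum.If_cases) (auto simp: Diff_eq intro: arg_cong[where f = card])
  also have "\<dots> = real m - real (card T)"
    using assms(1) finite_subset[OF assms(1)] card_mono[OF _ assms(1)]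
    by (simp add: card_Diff_subset of_nat_diff)
  finally show ?thesis
    using assms(2) by (auto simp: outlier_ind_def algebra_simps)
qed

section \<open>Contaminated datasets\<close>

text \<open>The common part \<open>M\<close> misses at most \<kappa> samples of \<open>D\<close>,
  hence at most \<kappa> with label \<open>s\<close>, and all of \<open>M\<close> survives in
  \<open>D'\<close>. Testing membership in \<open>set D\<close> may also count extra copies placed
  in \<open>D'\<close>; this only helps a lower bound.\<close>

lemma contaminated_card_common:
  assumes "D' \<in> contaminated \<kappa> D"
  shows "card (class_idx s D) \<le> card {i \<in> class_idx s D'. D' ! i \<in> set D} + \<kappa>"
proof -
  define M where "M = mset D' \<inter># mset D"
  have M: "M \<subseteq># mset D" "M \<subseteq># mset D'" by (simp_all add: M_def)
  have size_M: "length D \<le> size M + \<kappa>"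
    using assms by (auto simp: contaminated_def M_def)
  obtain N where N: "mset D = M + N"
    using M(1) by (auto simp: subset_mset.le_iff_add)
  then have "length D = size M + size N"
    by (metis size_mset size_union)
  then have size_N: "size N \<le> \<kappa>" using size_M by simp
  let ?P = "\<lambda>z. snd z = s"
  let ?Q = "\<lambda>z. snd z = s \<and> z \<in> set D"
  have "card (class_idx s D) = size (filter_mset ?P (mset D))"
    by (simp add: class_idx_def length_filter_conv_card flip: mset_filter)
  also have "\<dots> \<le> size (filter_mset ?P M) + \<kappa>"
    using order_trans[OF size_filter_mset_lesseq size_N] by (simp add: N)
  \<comment> \<open>Elements of \<open>M\<close> come from \<open>D\<close>, so the extra condition
    in \<open>?Q\<close> costs nothing here, whereas in \<open>mset D'\<close> it screens out
    foreign samples.\<close>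
  also have "filter_mset ?P M = filter_mset ?Q M"
    using M(1) by (intro filter_mset_cong) (auto dest: mset_subset_eqD)
  also have "size (filter_mset ?Q M) \<le> size (filter_mset ?Q (mset D'))"
    by (intro size_mset_mono multiset_filter_mono M)
  also have "\<dots> = card {i \<in> class_idx s D'. D' ! i \<in> set D}"
    by (simp add: class_idx_def length_filter_conv_card conj_assoc flip: mset_filter)
  finally show ?thesis by simp
qed

text \<open>The two lists agree off \<open>S\<close>, so the samples indexed by the complement of
  \<open>S\<close> form a common submultiset of size \<open>m - card S\<close>.\<close>

lemma contaminated_flip:
  assumes "is_dataset m D" "S \<subseteq> {..<m}"
  defines "D' \<equiv> map (\<lambda>i. if i \<in> S then (fst (D ! i), - snd (D ! i)) else D ! i) [0..<m]"
  shows "D' \<in> contaminated (card S) D"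
proof -
  let ?f = "\<lambda>i. if i \<in> S then (fst (D ! i), - snd (D ! i)) else D ! i"
  have len: "length D = m" and lab: "i < m \<Longrightarrow> snd (D ! i) \<in> {1, -1}" for i
    using assms(1) by (auto simp: is_dataset_def dest!: nth_mem)
  have fin: "finite S" using assms(2) finite_subset by blast
  have split: "mset_set {..<m} = mset_set ({..<m} - S) + mset_set S"
    using assms(2) fin by (subst mset_set_Union[symmetric]) (auto intro: arg_cong[where f = mset_set])
  let ?M = "image_mset ((!) D) (mset_set ({..<m} - S))"
  have "mset D' = image_mset ?f (mset_set {..<m})"
    by (simp add: D'_def mset_map atLeast0LessThan)
  also have "\<dots> = image_mset ?f (mset_set ({..<m} - S)) + image_mset ?f (mset_set S)"
    unfolding split by simp
  also have "image_mset ?f (mset_set ({..<m} - S)) = ?M"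
    by (intro image_mset_cong) auto
  finally have 1: "?M \<subseteq># mset D'" by simp
  have "mset D = image_mset ((!) D) (mset_set {..<m})"
    by (metis len map_nth mset_map mset_upt atLeast0LessThan)
  then have 2: "?M \<subseteq># mset D" unfolding split by simp
  have "card ({..<m} - S) = m - card S"
    using assms(2) fin by (simp add: card_Diff_subset)
  moreover have "size ?M \<le> size (mset D' \<inter># mset D)"
    by (intro size_mset_mono subset_mset.inf_greatest 1 2)
  moreover have "is_dataset m D'"
  proof -
    have "snd z \<in> {1, -1}" if "z \<in> set D'" for z
      using that lab by (fastforce simp: D'_def)
    then have "set D' \<subseteq> UNIV \<times> {1, -1}" by (fastforce simp: mem_Times_iff)
    then show ?thesis by (simp add: is_dataset_def D'_def)
  qed
  ultimately show ?thesis
    using len by (simp add: contaminated_def)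
qed

section \<open>Nonempty and empty reduced hulls\<close>

text \<open>Uniform weights on \<open>G\<close> have the smallest possible maximum, and the second
  inequality in \<open>c\<close> says that it respects the cap. Weight 0 off \<open>G\<close> is
  allowed because \<eta> is nonnegative.\<close>

lemma mean_mem_reduced_hull:
  assumes G: "G \<subseteq> class_idx s D" and \<eta>: "\<And>i. i \<in> G \<Longrightarrow> \<eta> i = 1"
    and \<eta>_nonneg: "\<And>i. i \<in> class_idx s D \<Longrightarrow> 0 \<le> \<eta> i"
    and c: "0 < (\<nu> - \<mu>) * real (length D)" "(\<nu> - \<mu>) * real (length D) \<le> 2 * real (card G)"
  shows "(\<lambda>u. \<Sum>i\<in>G. 1 / real (card G) * k u (fst (D ! i))) \<in> reduced_hull k s \<eta> \<nu> \<mu> D"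
proof -
  define \<gamma> where "\<gamma> i = (if i \<in> G then 1 / real (card G) else 0)" for i
  have pos: "0 < real (card G)" using c by linarith
  have restrict_sum: "(\<Sum>i\<in>class_idx s D. \<gamma> i * h i) = (\<Sum>i\<in>G. 1 / real (card G) * h i)" for h
    by (rule sum.mono_neutral_cong_right) (use G in \<open>auto simp: \<gamma>_def\<close>)
  have "(\<Sum>i\<in>class_idx s D. \<gamma> i) = 1"
    using restrict_sum[of "\<lambda>_. 1"] pos by simp
  moreover have "1 / real (card G) \<le> 2 / ((\<nu> - \<mu>) * real (length D))"
    using c pos by (subst frac_le_eq) (auto simp: divide_le_0_iff)
  then have "0 \<le> \<gamma> i \<and> \<gamma> i \<le> 2 * \<eta> i / ((\<nu> - \<mu>) * real (length D))"
    if "i \<in> class_idx s D" for i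
    using \<eta>[of i] \<eta>_nonneg[OF that] c(1) by (auto simp: \<gamma>_def)
  ultimately show ?thesis
    unfolding reduced_hull_def mem_Collect_eq
    by (intro exI[of _ \<gamma>]) (auto simp only: restrict_sum)
qed

lemma reduced_hull_empty:
  assumes T: "T \<subseteq> class_idx s D" "\<And>i. i \<in> T \<Longrightarrow> \<eta> i = 0"
    and one: "\<And>i. i \<in> class_idx s D - T \<Longrightarrow> \<eta> i = 1"
    and c: "0 < (\<nu> - \<mu>) * real (length D)"
      "2 * real (card (class_idx s D - T)) < (\<nu> - \<mu>) * real (length D)"
  shows "reduced_hull k s \<eta> \<nu> \<mu> D = {}"
proof -
  let ?c = "(\<nu> - \<mu>) * real (length D)"
  have False if sum: "(\<Sum>i\<in>class_idx s D. \<gamma> i) = 1"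
    and bd: "\<forall>i\<in>class_idx s D. 0 \<le> \<gamma> i \<and> \<gamma> i \<le> 2 * \<eta> i / ?c" for \<gamma>
  proof -
    \<comment> \<open>On \<open>T\<close> the cap is 0, which forces the weights there to vanish;
      the remaining caps add up to less than 1.\<close>
    have "1 = (\<Sum>i\<in>class_idx s D - T. \<gamma> i)"
      unfolding sum[symmetric]
      by (rule sum.mono_neutral_right) (use T bd in fastforce)+
    also have "\<dots> \<le> (\<Sum>i\<in>class_idx s D - T. 2 / ?c)"
      by (intro sum_mono) (use bd one in fastforce)
    also have "\<dots> = 2 * real (card (class_idx s D - T)) / ?c" by simp
    also have "\<dots> < 1" using c by (simp only: divide_less_eq_1_pos)
    finally show False by simp
  qed
  then show ?thesis unfolding reduced_hull_def by blast
qed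

section \<open>Bounding \<open>opt\<close> from above and forcing it to be infinite\<close>

lemma opt_le:
  assumes "0 \<le> \<mu>"
    and "\<And>\<eta>. \<eta> \<in> outlier_ind (length D) \<mu> \<Longrightarrow>
      \<exists>f \<in> hull_diff k \<eta> \<nu> \<mu> D. (hnorm ip f)\<^sup>2 \<le> C"
  shows "opt ip k \<nu> \<mu> D \<le> ereal C"
proof -
  have "(INF f \<in> hull_diff k \<eta> \<nu> \<mu> D. ereal ((hnorm ip f)\<^sup>2)) \<le> ereal C"
    if "\<eta> \<in> outlier_ind (length D) \<mu>" for \<eta>
    using assms(2)[OF that] by (meson INF_lower2 ereal_less_eq(3))
  then show ?thesis
    unfolding opt_def using finite_outlier_ind outlier_ind_nonempty[OF assms(1)]
    by (subst Max_le_iff) auto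
qed

lemma opt_eq_infinity:
  assumes "\<eta> \<in> outlier_ind (length D) \<mu>" "hull_diff k \<eta> \<nu> \<mu> D = {}"
  shows "opt ip k \<nu> \<mu> D = \<infinity>"
proof -
  have "(INF f \<in> hull_diff k \<eta> \<nu> \<mu> D. ereal ((hnorm ip f)\<^sup>2)) \<le> opt ip k \<nu> \<mu> D"
    unfolding opt_def using assms(1) finite_outlier_ind by (intro Max_ge) auto
  then show ?thesis using assms(2) by (simp add: top_ereal_def)
qed

text \<open>The bound does not depend on \<open>D'\<close>. The factor 4 is the square of 2, the
  total absolute weight of a difference of two means.\<close>

lemma (in rkhs) opt_contaminated_le:
  assumes \<mu>: "0 \<le> \<mu>" "\<mu> * real (length D) = real \<kappa>"
    and size: "\<And>s. s \<in> {1, -1} \<Longrightarrow> n \<le> card (class_idx s D)"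
    and n: "2 * \<kappa> < n"
    and c: "0 < (\<nu> - \<mu>) * real (length D)" "(\<nu> - \<mu>) * real (length D) \<le> 2 * (real n - 2 * real \<kappa>)"
    and D': "D' \<in> contaminated \<kappa> D"
    and B: "\<And>x y. x \<in> fst ` set D \<Longrightarrow> y \<in> fst ` set D \<Longrightarrow> \<bar>k x y\<bar> \<le> B"
  shows "opt ip k \<nu> \<mu> D' \<le> ereal (4 * B)"
proof (rule opt_le[OF \<mu>(1)])
  fix \<eta> assume "\<eta> \<in> outlier_ind (length D') \<mu>"
  have len: "length D' = length D"
    using D' by (simp add: contaminated_def is_dataset_def)
  then have \<eta>: "\<eta> \<in> outlier_ind (length D) \<mu>"
    using \<open>\<eta> \<in> _\<close> by simp
  \<comment> \<open>The samples labelled \<open>s\<close> that are original and not discarded;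
    contamination and \<eta> each cost at most \<kappa> of them.\<close>
  define G where "G s = {i \<in> class_idx s D'. D' ! i \<in> set D \<and> \<eta> i = 1}" for s
  define w where "w s = 1 / real (card (G s))" for s
  have fin: "finite (G s)" for s by (simp add: G_def)
  have card_G: "n \<le> card (G s) + 2 * \<kappa>" if "s \<in> {1, -1}" for s
  proof -
    let ?Z = "{i. i < length D \<and> \<eta> i \<noteq> 1}"
    have "{i \<in> class_idx s D'. D' ! i \<in> set D} \<subseteq> G s \<union> ?Z"
      by (auto simp: G_def class_idx_def len)
    then have "card {i \<in> class_idx s D'. D' ! i \<in> set D} \<le> card (G s \<union> ?Z)"
      by (intro card_mono) (simp_all add: fin)
    also have "\<dots> \<le> card (G s) + card ?Z" by (rule card_Un_le)
    also have "\<dots> \<le> card (G s) + \<kappa>"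
      using outlier_ind_card_zero_le[OF \<eta> \<mu>(2)] by simp
    finally show ?thesis
      using contaminated_card_common[OF D', of s] size[OF that] by linarith
  qed
  have ne: "G s \<noteq> {}" if "s \<in> {1, -1}" for s
    using card_G[OF that] n by auto
  have hull: "(\<lambda>u. \<Sum>i\<in>G s. w s * k u (fst (D' ! i))) \<in> reduced_hull k s \<eta> \<nu> \<mu> D'"
    if "s \<in> {1, -1}" for s
    unfolding w_def
  proof (rule mean_mem_reduced_hull)
    show "0 \<le> \<eta> i" if "i \<in> class_idx s D'" for i
      using \<eta> that by (force simp: outlier_ind_def class_idx_def len PiE_def Pi_def)
    have "real n \<le> real (card (G s)) + 2 * real \<kappa>"
      using card_G[OF that] by linarith
    then show "(\<nu> - \<mu>) * real (length D') \<le> 2 * real (card (G s))"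
      using c(2) by (simp add: len)
  qed (use c in \<open>auto simp: G_def len\<close>)
  let ?I = "G 1 \<union> G (-1)"
  \<comment> \<open>Signed weights on the disjoint union make the difference of the two means a
    single kernel combination, to which the norm estimate applies.\<close>
  define v where "v i = (if i \<in> G 1 then w 1 else - w (-1))" for i
  let ?f = "\<lambda>u. \<Sum>i\<in>?I. v i * k u (fst (D' ! i))"
  have disj: "G 1 \<inter> G (-1) = {}"
    using class_idx_disjoint[of 1 "-1" D'] by (auto simp: G_def)
  have sum_I: "(\<Sum>i\<in>?I. h (v i) i) = (\<Sum>i\<in>G 1. h (w 1) i) + (\<Sum>i\<in>G (-1). h (- w (-1)) i)"
    for h :: "real \<Rightarrow> nat \<Rightarrow> real"
  proof -
    have "v i = - w (-1)" if "i \<in> G (-1)" for i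
      using disj that by (auto simp: v_def)
    then show ?thesis
      by (simp add: sum.union_disjoint[OF fin fin disj] v_def)
  qed
  have f: "?f = (\<lambda>u. (\<Sum>i\<in>G 1. w 1 * k u (fst (D' ! i))) - (\<Sum>i\<in>G (-1). w (-1) * k u (fst (D' ! i))))"
  proof
    show "?f u = (\<Sum>i\<in>G 1. w 1 * k u (fst (D' ! i))) - (\<Sum>i\<in>G (-1). w (-1) * k u (fst (D' ! i)))" for u
      using sum_I[of "\<lambda>c i. c * k u (fst (D' ! i))"] by (simp add: sum_negf)
  qed
  have "?f \<in> hull_diff k \<eta> \<nu> \<mu> D'"
    unfolding f hull_diff_def mem_Collect_eq
    using hull[of 1] hull[of "-1"] by (intro exI conjI refl) simp_all
  moreover have "(\<Sum>i\<in>?I. \<bar>v i\<bar>) = 2"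
    by (subst sum_I[where h = "\<lambda>c i. \<bar>c\<bar>"]) (use fin ne in \<open>simp add: w_def\<close>)
  then have "(hnorm ip ?f)\<^sup>2 \<le> 4 * B"
    using hnorm_kernel_sum_le[of ?I "\<lambda>i. fst (D' ! i)" B v] fin B
    by (simp add: G_def image_def) blast
  ultimately show "\<exists>f\<in>hull_diff k \<eta> \<nu> \<mu> D'. (hnorm ip f)\<^sup>2 \<le> 4 * B"
    by blast
qed

text \<open>The hypothesis \<open>n\<close> leaves room for disjoint sets \<open>S\<close> and
  \<open>T\<close> of size \<kappa> inside the class: one to flip, one to discard. A single \<eta>
  with an empty hull suffices, as \<open>opt\<close> maximises over \<eta>.\<close>

lemma exists_contaminated_opt_infinity:
  assumes D: "is_dataset m D" and \<mu>: "\<mu> * real m = real \<kappa>"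
    and s: "s \<in> {1, -1}" and n: "2 * \<kappa> \<le> card (class_idx s D)"
    and c: "0 < (\<nu> - \<mu>) * real m"
      "2 * (real (card (class_idx s D)) - 2 * real \<kappa>) < (\<nu> - \<mu>) * real m"
  shows "\<exists>D' \<in> contaminated \<kappa> D. opt ip k \<nu> \<mu> D' = \<infinity>"
proof -
  have len: "length D = m" using D by (simp add: is_dataset_def)
  have "\<kappa> \<le> card (class_idx s D)" using n by simp
  then obtain S where S: "S \<subseteq> class_idx s D" "card S = \<kappa>"
    by (rule obtain_subset_with_card_n)
  have fin: "finite S" using S(1) finite_subset finite_class_idx by blast
  have card_diff: "card (class_idx s D - S) = card (class_idx s D) - \<kappa>"
    using S fin by (simp add: card_Diff_subset)
  then have "\<kappa> \<le> card (class_idx s D - S)" using n by simp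
  then obtain T where T: "T \<subseteq> class_idx s D - S" "card T = \<kappa>" "finite T"
    by (rule obtain_subset_with_card_n)
  have sub: "class_idx s D \<subseteq> {..<m}" by (auto simp: class_idx_def len)
  define D' where "D' = map (\<lambda>i. if i \<in> S then (fst (D ! i), - snd (D ! i)) else D ! i) [0..<m]"
  define \<eta> :: "nat \<Rightarrow> real" where "\<eta> = restrict (\<lambda>i. if i \<in> T then 0 else 1) {..<m}"
  have D'_mem: "D' \<in> contaminated \<kappa> D"
    unfolding D'_def S(2)[symmetric] by (rule contaminated_flip[OF D]) (use S sub in auto)
  have len': "length D' = m" by (simp add: D'_def)
  \<comment> \<open>Only samples labelled \<open>s\<close> are flipped, so some leave the class and
    none enter it.\<close>
  have idx: "class_idx s D' = class_idx s D - S"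
  proof -
    have "snd (D ! i) = s" if "i \<in> S" for i
      using S(1) that by (auto simp: class_idx_def)
    moreover have "- s \<noteq> s" using s by auto
    ultimately have "snd (D' ! i) = s \<longleftrightarrow> snd (D ! i) = s \<and> i \<notin> S" if "i < m" for i
      using that by (cases "i \<in> S") (simp_all add: D'_def)
    then show ?thesis
      unfolding class_idx_def len len' by blast
  qed
  have "reduced_hull k s \<eta> \<nu> \<mu> D' = {}"
  proof (rule reduced_hull_empty)
    have "card (class_idx s D' - T) = card (class_idx s D) - \<kappa> - \<kappa>"
      using T card_diff by (simp add: idx card_Diff_subset)
    then show "2 * real (card (class_idx s D' - T)) < (\<nu> - \<mu>) * real (length D')"
      using c(2) n by (simp add: len' of_nat_diff)
  qed (use T sub c(1) in \<open>auto simp: idx len' \<eta>_def\<close>)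
  then have "hull_diff k \<eta> \<nu> \<mu> D' = {}"
    using s by (auto simp: hull_diff_def)
  moreover have "\<eta> \<in> outlier_ind (length D') \<mu>"
    unfolding \<eta>_def len' using T sub \<mu> by (intro outlier_ind_discard) auto
  ultimately show ?thesis using D'_mem opt_eq_infinity by blast
qed

theorem theorem1:
  fixes H :: "('x \<Rightarrow> real) set"
    and ip :: "('x \<Rightarrow> real) \<Rightarrow> ('x \<Rightarrow> real) \<Rightarrow> real"
    and k :: "'x \<Rightarrow> 'x \<Rightarrow> real"
    and m \<kappa> :: nat
    and D :: "'x dataset"
    and r \<nu> \<mu> :: real
  assumes "rkhs H ip k"
    and "is_dataset m D"
    and "r = label_ratio D"
    and "r > 0"
    and "0 \<le> \<mu>" and "\<mu> < \<nu>" and "\<nu> < 1"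
    and "\<nu> * real m \<in> \<nat>"
    and "\<mu> * real m = real \<kappa>"
    and "\<mu> < r / 2"
  shows "\<nu> - \<mu> \<le> 2 * (r - 2 * \<mu>) \<longleftrightarrow>
    (SUP D' \<in> contaminated \<kappa> D. opt ip k \<nu> \<mu> D') < \<infinity>"
proof -
  interpret rkhs H ip k by fact
  define n where "n = min (card (class_idx 1 D)) (card (class_idx (-1) D))"
  have len: "length D = m" using assms(2) by (simp add: is_dataset_def)
  \<comment> \<open>An empty dataset would have label ratio 0, against \<open>r > 0\<close>.\<close>
  have m: "0 < real m"
    using assms(3,4) by (cases "m = 0") (auto simp: label_ratio_def len)
  have rm: "r * real m = real n"
    using m unfolding assms(3) label_ratio_def n_def len by simp
  have "2 * \<mu> * real m < r * real m"
    using assms(10) m by (intro mult_strict_right_mono) auto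
  then have n\<kappa>: "2 * \<kappa> < n"
    using assms(9) rm by linarith
  have cpos: "0 < (\<nu> - \<mu>) * real m" using assms(6) m by simp
  \<comment> \<open>Multiplying by \<open>m\<close> restates condition (i) as a comparison of sample
    counts.\<close>
  have "\<nu> - \<mu> \<le> 2 * (r - 2 * \<mu>) \<longleftrightarrow> (\<nu> - \<mu>) * real m \<le> 2 * (r - 2 * \<mu>) * real m"
    using m by (simp only: mult_le_cancel_right_pos)
  also have "2 * (r - 2 * \<mu>) * real m = 2 * (real n - 2 * real \<kappa>)"
    using rm assms(9) by (simp add: algebra_simps)
  finally have i_iff: "\<nu> - \<mu> \<le> 2 * (r - 2 * \<mu>) \<longleftrightarrow>
    (\<nu> - \<mu>) * real m \<le> 2 * (real n - 2 * real \<kappa>)" .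
  show ?thesis
  proof
    assume "\<nu> - \<mu> \<le> 2 * (r - 2 * \<mu>)"
    then have c: "(\<nu> - \<mu>) * real m \<le> 2 * (real n - 2 * real \<kappa>)" using i_iff by simp
    let ?X = "fst ` set D"
    \<comment> \<open>A crude bound: the sum of all absolute kernel values on the finitely many
      points of \<open>D\<close> dominates each of them.\<close>
    define B where "B = (\<Sum>(x, y)\<in>?X \<times> ?X. \<bar>k x y\<bar>)"
    have B: "\<bar>k x y\<bar> \<le> B" if "x \<in> ?X" "y \<in> ?X" for x y
      using member_le_sum[of "(x, y)" "?X \<times> ?X" "\<lambda>(x, y). \<bar>k x y\<bar>"] that
      by (auto simp: B_def)
    have "(SUP D' \<in> contaminated \<kappa> D. opt ip k \<nu> \<mu> D') \<le> ereal (4 * B)"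
    proof (rule SUP_least)
      fix D' assume "D' \<in> contaminated \<kappa> D"
      show "opt ip k \<nu> \<mu> D' \<le> ereal (4 * B)"
        by (rule opt_contaminated_le[where n = n and D = D and \<kappa> = \<kappa>])
          (use assms(5,9) n\<kappa> cpos c \<open>D' \<in> _\<close> B in \<open>auto simp: len n_def\<close>)
    qed
    also have "\<dots> < \<infinity>" by simp
    finally show "(SUP D' \<in> contaminated \<kappa> D. opt ip k \<nu> \<mu> D') < \<infinity>" .
  next
    assume fin: "(SUP D' \<in> contaminated \<kappa> D. opt ip k \<nu> \<mu> D') < \<infinity>"
    show "\<nu> - \<mu> \<le> 2 * (r - 2 * \<mu>)"
    proof (rule ccontr)
      assume "\<not> ?thesis"
      then have c: "2 * (real n - 2 * real \<kappa>) < (\<nu> - \<mu>) * real m" using i_iff by simp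
      \<comment> \<open>The label of a smallest class, the one to attack.\<close>
      obtain s :: int where s: "s \<in> {1, -1}" "n = card (class_idx s D)"
        unfolding n_def min_def by (metis insertCI)
      obtain D' where "D' \<in> contaminated \<kappa> D" "opt ip k \<nu> \<mu> D' = \<infinity>"
        using exists_contaminated_opt_infinity[OF assms(2,9) s(1) _ cpos, of ip k] n\<kappa> c s(2)
        by auto
      then have "\<infinity> \<le> (SUP D' \<in> contaminated \<kappa> D. opt ip k \<nu> \<mu> D')"
        by (metis SUP_upper)
      then show False using fin by simp
    qed
  qed
qed

end
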